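(* Let $\mathscr{H}$ be a complex Hilbert space and let $A,B\in\mathbb{B}(\mathscr{H})$. Then $$w\begin{pmatrix} O&A\\ B&O\end{pmatrix}\geq \frac12\big\|\Re(A)+\mathrm{i}\,\Im(B)\big\|+\frac14\Big|\,\|A+B^*\|-\|A-B^*\|\,\Big|$$ and $$w\begin{pmatrix} O&A\\ B&O\end{pmatrix}\geq \frac12\big\|\Re(B)+\mathrm{i}\,\Im(A)\big\|+\frac14\Big|\,\|A+B^*\|-\|A-B^*\|\,\Big|.$$
   Context: $\mathbb{B}(\mathscr{H})$ is the $C^*$-algebra of bounded linear operators on $\mathscr{H}$, and $O$ is the zero operator. For a bounded operator $T$ on a complex Hilbert space: $\|T\|$ is the operator norm; $\Re(T)=\frac12(T+T^* )$ and $\Im(T)=\frac{1}{2\mathrm{i}}(T-T^* )$; the numerical radius is $w(T)=\sup\{|\langle Tx,x\rangle| : \|x\|=1\}$. The operator matrix $\begin{pmatrix} O&A\\ B&O\end{pmatrix}$ is the operator $(x,y)\mapsto (Ay,Bx)$ on the Hilbert space direct sum $\mathscr{H}\oplus\mathscr{H}$. *)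

theory Defs
  imports "HOL-Analysis.Analysis"
begin

text \<open>Complex inner product spaces, built on the real inner product spaces of the library: the
  underlying real inner product is the real part of the complex one, so norm and topology are the
  library's, \<open>norm x = sqrt (Re (cinner x x))\<close>. The inner product is linear in its first argument.\<close>

class complex_inner = real_inner +
  fixes scaleC :: "complex \<Rightarrow> 'a \<Rightarrow> 'a"  (infixr "*\<^sub>C" 75)
    and cinner :: "'a \<Rightarrow> 'a \<Rightarrow> complex"
  assumes scaleC_add_right: "c *\<^sub>C (x + y) = c *\<^sub>C x + c *\<^sub>C y"
    and scaleC_add_left: "(c + d) *\<^sub>C x = c *\<^sub>C x + d *\<^sub>C x"
    and scaleC_scaleC: "c *\<^sub>C d *\<^sub>C x = (c * d) *\<^sub>C x"
    and scaleC_one: "1 *\<^sub>C x = x"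
    and scaleR_scaleC: "r *\<^sub>R x = complex_of_real r *\<^sub>C x"
    and cinner_commute: "cinner x y = cnj (cinner y x)"
    and cinner_add_left: "cinner (x + y) z = cinner x z + cinner y z"
    and cinner_scaleC_left: "cinner (c *\<^sub>C x) y = c * cinner x y"
    and inner_eq_Re_cinner: "x \<bullet> y = Re (cinner x y)"

class complex_hilbert_space = complex_inner + complete_space

instantiation complex :: complex_hilbert_space
begin
definition scaleC_complex :: "complex \<Rightarrow> complex \<Rightarrow> complex"
  where "scaleC_complex c x = c * x"
definition cinner_complex :: "complex \<Rightarrow> complex \<Rightarrow> complex"
  where "cinner_complex x y = x * cnj y"
instance
  by standard
    (auto simp: scaleC_complex_def cinner_complex_def algebra_simps scaleR_conv_of_real
      inner_complex_def)
end

text \<open>The Hilbert space direct sum; its norm is the library's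
  \<open>norm (x, y) = sqrt ((norm x)\<^sup>2 + (norm y)\<^sup>2)\<close>.\<close>

instantiation prod :: (complex_inner, complex_inner) complex_inner
begin
definition scaleC_prod :: "complex \<Rightarrow> 'a \<times> 'b \<Rightarrow> 'a \<times> 'b"
  where "scaleC_prod c p = (c *\<^sub>C fst p, c *\<^sub>C snd p)"
definition cinner_prod :: "'a \<times> 'b \<Rightarrow> 'a \<times> 'b \<Rightarrow> complex"
  where "cinner_prod p q = cinner (fst p) (fst q) + cinner (snd p) (snd q)"
instance
proof
  fix x y :: "'a \<times> 'b"
  show "cinner x y = cnj (cinner y x)"
    unfolding cinner_prod_def
    by (metis cinner_commute complex_cnj_add)
qed (auto simp: scaleC_prod_def cinner_prod_def scaleC_add_right scaleC_add_left scaleC_scaleC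
      scaleC_one scaleR_scaleC cinner_add_left cinner_scaleC_left inner_eq_Re_cinner
      inner_prod_def algebra_simps scaleR_prod_def)
end

instance prod :: (complex_hilbert_space, complex_hilbert_space) complex_hilbert_space ..

definition bounded_clinear :: "('a::complex_inner \<Rightarrow> 'b::complex_inner) \<Rightarrow> bool"
  where "bounded_clinear T \<longleftrightarrow> bounded_linear T \<and> (\<forall>c x. T (c *\<^sub>C x) = c *\<^sub>C T x)"

text \<open>The defining property determines the adjoint uniquely; it exists for every bounded operator
  on a Hilbert space. The library's \<open>adjoint\<close> refers to the real inner product.\<close>

definition cadjoint :: "('a::complex_inner \<Rightarrow> 'b::complex_inner) \<Rightarrow> 'b \<Rightarrow> 'a"
  where "cadjoint T = (THE S. \<forall>x y. cinner (T x) y = cinner x (S y))"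

definition Re_op :: "('a::complex_inner \<Rightarrow> 'a) \<Rightarrow> 'a \<Rightarrow> 'a"
  where "Re_op T = (\<lambda>x. (1 / 2) *\<^sub>C (T x + cadjoint T x))"

definition Im_op :: "('a::complex_inner \<Rightarrow> 'a) \<Rightarrow> 'a \<Rightarrow> 'a"
  where "Im_op T = (\<lambda>x. (1 / (2 * \<i>)) *\<^sub>C (T x - cadjoint T x))"

text \<open>Inserting \<open>0\<close> matters only on the zero space, where there are no unit vectors: it makes
  the numerical radius \<open>0\<close> there.\<close>

definition numerical_radius :: "('a::complex_inner \<Rightarrow> 'a) \<Rightarrow> real"
  where "numerical_radius T = Sup (insert 0 {cmod (cinner (T x) x) |x. norm x = 1})"

text \<open>The operator matrix with zero diagonal, upper right entry \<open>A\<close> and lower left entry \<open>B\<close>.\<close>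

definition offdiag :: "('a \<Rightarrow> 'a) \<Rightarrow> ('a \<Rightarrow> 'a) \<Rightarrow> 'a \<times> 'a \<Rightarrow> 'a \<times> 'a"
  where "offdiag A B = (\<lambda>(x, y). (A y, B x))"

end

theory Submission
  imports Defs
begin

text \<open>Write \<open>w\<close> for the numerical radius of the operator matrix, \<open>S = A + B*\<close> and \<open>D = A - B*\<close>.
  The quadratic form of the matrix at \<open>(x, y)\<close> is \<open>\<langle>Ay, x\<rangle> + \<langle>Bx, y\<rangle>\<close>, and \<open>\<langle>Bx, y\<rangle>\<close> is the conjugate of
  \<open>\<langle>B*y, x\<rangle>\<close>. Hence its real part is the real part of \<open>\<langle>Sy, x\<rangle>\<close> and its imaginary part is the imaginary
  part of \<open>\<langle>Dy, x\<rangle>\<close>. Both are at most \<open>w (\<parallel>x\<parallel>\<^sup>2 + \<parallel>y\<parallel>\<^sup>2)\<close>, and optimising over \<open>x\<close> gives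
  \<open>\<parallel>S\<parallel> \<le> 2 w\<close> and \<open>\<parallel>D\<parallel> \<le> 2 w\<close>. Therefore
  \<open>w \<ge> max \<parallel>S\<parallel> \<parallel>D\<parallel> / 2 = (\<parallel>S\<parallel> + \<parallel>D\<parallel>) / 4 + \<bar>\<parallel>S\<parallel> - \<parallel>D\<parallel>\<bar> / 4\<close>.

  On the other hand \<open>2 (\<Re> A + \<i> \<Im> B) = A + A* + B - B* = D + S*\<close> and
  \<open>2 (\<Re> B + \<i> \<Im> A) = S - D*\<close>. Since an operator and its adjoint have the same norm, the norms of
  both combinations \<open>\<Re> A + \<i> \<Im> B\<close> and \<open>\<Re> B + \<i> \<Im> A\<close> are at most \<open>(\<parallel>S\<parallel> + \<parallel>D\<parallel>) / 2\<close>, which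
  turns the bound above into the two claims.

  The adjoint is given by a definite description, so all this rests on its existence, which is
  derived from the Riesz representation theorem (\<open>riesz_representation\<close>).\<close>

section \<open>Riesz representation\<close>

text \<open>The representing vector minimises \<open>J x = \<parallel>x\<parallel>\<^sup>2 - 2 f x\<close>. By the parallelogram law every
  minimising sequence is Cauchy, so a minimiser exists by completeness; the first-order condition
  at the minimiser is the claimed identity.\<close>

lemma riesz_representation:
  fixes f :: "'a::{real_inner, complete_space} \<Rightarrow> real"
  assumes "bounded_linear f"
  shows "\<exists>u. \<forall>x. f x = x \<bullet> u"
proof -
  interpret f: bounded_linear f by fact
  define J where "J x = (norm x)\<^sup>2 - 2 * f x" for x
  define m where "m = Inf (range J)"
  obtain K where K: "\<And>x. norm (f x) \<le> norm x * K"
    using f.bounded by blast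
  have "J x \<ge> - K\<^sup>2" for x
  proof -
    have "f x \<le> norm x * K" using K[of x] by auto
    moreover have "0 \<le> (norm x - K)\<^sup>2" by simp
    ultimately show ?thesis unfolding J_def by (simp add: power2_diff)
  qed
  then have bdd: "bdd_below (range J)" by (auto intro!: bdd_belowI2[where m = "- K\<^sup>2"])
  have m_le: "m \<le> J x" for x
    unfolding m_def using bdd by (simp add: cInf_lower)
  have "\<exists>x. J x < m + 1 / real (Suc n)" for n
    using cInf_lessD[of "range J" "m + 1 / real (Suc n)"] unfolding m_def by auto
  then obtain X where X: "\<And>n. J (X n) < m + 1 / real (Suc n)" by metis
  have J_parallelogram: "(norm (x - y))\<^sup>2 = 2 * J x + 2 * J y - 4 * J ((1/2) *\<^sub>R (x + y))" for x y
    unfolding J_def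
    by (simp add: f.add f.scaleR power_mult_distrib power2_norm_eq_inner inner_simps
        inner_commute algebra_simps)
  have dist_X: "(norm (X i - X j))\<^sup>2 < 4 / real (Suc N)" if "i \<ge> N" "j \<ge> N" for i j N
  proof -
    have "1 / real (Suc i) \<le> 1 / real (Suc N)" "1 / real (Suc j) \<le> 1 / real (Suc N)"
      using that by (auto intro!: divide_left_mono)
    then have "J (X i) < m + 1 / real (Suc N)" "J (X j) < m + 1 / real (Suc N)"
      using X[of i] X[of j] by linarith+
    then show ?thesis
      using J_parallelogram[of "X i" "X j"] m_le[of "(1/2) *\<^sub>R (X i + X j)"] by simp
  qed
  have "Cauchy X"
  proof (rule metric_CauchyI)
    fix e :: real assume e: "0 < e"
    obtain N where N: "1 / real (Suc N) < e\<^sup>2 / 4"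
      using nat_approx_posE[of "e\<^sup>2 / 4"] e by auto
    have "dist (X i) (X j) < e" if "i \<ge> N" "j \<ge> N" for i j
    proof -
      have "(norm (X i - X j))\<^sup>2 < e\<^sup>2" using dist_X[OF that] N by simp
      then show ?thesis using e by (simp add: dist_norm power_less_imp_less_base)
    qed
    then show "\<exists>M. \<forall>m\<ge>M. \<forall>n\<ge>M. dist (X m) (X n) < e" by blast
  qed
  then obtain u where u: "X \<longlonglongrightarrow> u"
    using Cauchy_convergent convergent_def by blast
  have "(\<lambda>n. J (X n)) \<longlonglongrightarrow> J u"
    unfolding J_def by (intro tendsto_intros u f.tendsto)
  moreover have "(\<lambda>n. m + 1 / real (Suc n)) \<longlonglongrightarrow> m + 0"
    by (intro tendsto_intros lim_1_over_n LIMSEQ_Suc)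
  ultimately have "J u \<le> m + 0"
    by (rule LIMSEQ_le) (use X less_imp_le in blast)
  then have min: "J u \<le> J x" for x using m_le[of x] by simp
  have "f h = h \<bullet> u" for h
  proof (cases "h = 0")
    case False
    define d where "d = h \<bullet> u - f h"
    define t where "t = - d / (norm h)\<^sup>2"
    have h: "(norm h)\<^sup>2 > 0" using False by simp
    have "J (u + t *\<^sub>R h) = J u + 2 * t * d + t\<^sup>2 * (norm h)\<^sup>2"
      unfolding J_def d_def power2_norm_eq_inner
      by (simp add: f.add f.scaleR inner_simps inner_commute algebra_simps power2_eq_square)
    also have "\<dots> = J u - d\<^sup>2 / (norm h)\<^sup>2"
      unfolding t_def using h by (simp add: field_simps power2_eq_square)
    finally have "d\<^sup>2 / (norm h)\<^sup>2 \<le> 0" using min[of "u + t *\<^sub>R h"] by simp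
    then have "d = 0" using h by (simp add: divide_le_0_iff)
    then show ?thesis by (simp add: d_def)
  qed simp
  then show ?thesis by blast
qed

section \<open>Complex inner products\<close>

lemma cinner_add_right: "cinner x (y + z) = cinner x y + cinner x z"
  by (metis cinner_add_left cinner_commute complex_cnj_add)

lemma cinner_scaleC_right: "cinner x (c *\<^sub>C y) = cnj c * cinner x y"
  by (metis cinner_commute cinner_scaleC_left complex_cnj_mult)

lemma cinner_diff_left: "cinner (x - y) z = cinner x z - cinner y z"
  by (metis add_diff_cancel_right' cinner_add_left diff_add_cancel)

lemma cinner_diff_right: "cinner x (y - z) = cinner x y - cinner x z"
  by (metis cinner_diff_left cinner_commute complex_cnj_diff)

lemma cinner_self: "cinner x x = complex_of_real ((norm x)\<^sup>2)"
proof (rule complex_eqI)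
  show "Re (cinner x x) = Re (complex_of_real ((norm x)\<^sup>2))"
    using inner_eq_Re_cinner[of x x] by (simp add: power2_norm_eq_inner)
  have "cinner x x = cnj (cinner x x)" by (rule cinner_commute)
  then have "Im (cinner x x) = - Im (cinner x x)" by (metis cnj.simps(2))
  then show "Im (cinner x x) = Im (complex_of_real ((norm x)\<^sup>2))" by simp
qed

lemma cinner_ext:
  assumes "\<And>x. cinner x y = cinner x z"
  shows "y = z"
proof -
  have "cinner (y - z) (y - z) = 0" by (simp add: cinner_diff_right assms)
  then show ?thesis by (simp add: cinner_self)
qed

lemma norm_scaleC: "norm (c *\<^sub>C x) = cmod c * norm x"
proof -
  have "complex_of_real ((norm (c *\<^sub>C x))\<^sup>2) = c * cnj c * complex_of_real ((norm x)\<^sup>2)"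
    unfolding cinner_self[symmetric] by (simp add: cinner_scaleC_left cinner_scaleC_right)
  also have "\<dots> = complex_of_real ((cmod c * norm x)\<^sup>2)"
    by (simp only: power_mult_distrib of_real_mult complex_norm_square[of c])
  finally have "(norm (c *\<^sub>C x))\<^sup>2 = (cmod c * norm x)\<^sup>2" using of_real_eq_iff by blast
  then show ?thesis by (simp add: power2_eq_iff_nonneg)
qed

text \<open>A phase rotates the complex inner product onto the nonnegative real axis, where the real
  Cauchy-Schwarz inequality applies.\<close>

lemma cmod_cinner_le: "cmod (cinner x y) \<le> norm x * norm y"
proof (cases "cinner x y = 0")
  case False
  define z where "z = cinner x y"
  define c where "c = cnj z / complex_of_real (cmod z)"
  have z: "z \<noteq> 0" using False z_def by simp
  have c: "cmod c = 1" using z by (simp add: c_def norm_divide)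
  have "c * z = complex_of_real (cmod z)"
    using z by (simp add: c_def mult.commute[of "cnj z"] complex_norm_square[symmetric] power2_eq_square)
  then have "cmod z = Re (cinner (c *\<^sub>C x) y)" by (simp add: cinner_scaleC_left z_def)
  also have "\<dots> = (c *\<^sub>C x) \<bullet> y" by (simp add: inner_eq_Re_cinner)
  also have "\<dots> \<le> norm (c *\<^sub>C x) * norm y" by (rule norm_cauchy_schwarz)
  finally show ?thesis by (simp add: norm_scaleC c z_def)
qed simp

section \<open>The adjoint\<close>

text \<open>Riesz represents the real functional \<open>x \<mapsto> Re \<langle>Tx, y\<rangle>\<close>. This determines the real part only;
  the imaginary part follows by replacing \<open>x\<close> by \<open>\<i> x\<close>.\<close>

lemma cadjoint_exists:
  fixes T :: "'a::complex_hilbert_space \<Rightarrow> 'b::complex_inner"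
  assumes "bounded_clinear T"
  shows "\<exists>S. \<forall>x y. cinner (T x) y = cinner x (S y)"
proof -
  have T: "bounded_linear T" and Tc: "\<And>c x. T (c *\<^sub>C x) = c *\<^sub>C T x"
    using assms by (auto simp: bounded_clinear_def)
  have "\<exists>u. \<forall>x. cinner (T x) y = cinner x u" for y
  proof -
    have "bounded_linear (\<lambda>x. T x \<bullet> y)"
      using T by (rule bounded_linear_inner_left_comp)
    then obtain u where u: "\<And>x. T x \<bullet> y = x \<bullet> u"
      using riesz_representation by metis
    have Re_eq: "Re (cinner (T x) y) = Re (cinner x u)" for x
      using u by (simp add: inner_eq_Re_cinner)
    have "Im (cinner (T x) y) = Im (cinner x u)" for x
      using Re_eq[of "\<i> *\<^sub>C x"] by (simp add: Tc cinner_scaleC_left)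
    then show ?thesis using Re_eq complex_eqI by blast
  qed
  then show ?thesis by metis
qed

lemma cinner_cadjoint:
  fixes T :: "'a::complex_hilbert_space \<Rightarrow> 'b::complex_inner"
  assumes "bounded_clinear T"
  shows "cinner (T x) y = cinner x (cadjoint T y)"
proof -
  obtain S where S: "\<forall>x y. cinner (T x) y = cinner x (S y)"
    using cadjoint_exists[OF assms] by blast
  moreover have "R = S" if "\<forall>x y. cinner (T x) y = cinner x (R y)" for R
    using that S by (metis cinner_ext ext)
  ultimately have "\<forall>x y. cinner (T x) y = cinner x (cadjoint T y)"
    unfolding cadjoint_def by (rule theI)
  then show ?thesis by blast
qed

text \<open>Apply the bound on \<open>S\<close> at \<open>R y\<close>: \<open>\<parallel>R y\<parallel>\<^sup>2 = \<langle>S (R y), y\<rangle> \<le> s \<parallel>R y\<parallel> \<parallel>y\<parallel>\<close>.\<close>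

lemma norm_adjoint_le:
  assumes adj: "\<And>x y. cinner (S x) y = cinner x (R y)"
    and "0 \<le> s" and bound: "\<And>x. norm (S x) \<le> s * norm x"
  shows "norm (R y) \<le> s * norm y"
proof (cases "R y = 0")
  case True
  then show ?thesis using \<open>0 \<le> s\<close> by simp
next
  case False
  have "(norm (R y))\<^sup>2 = cmod (cinner (S (R y)) y)"
    by (simp add: adj cinner_self norm_power)
  also have "\<dots> \<le> norm (S (R y)) * norm y" by (rule cmod_cinner_le)
  also have "\<dots> \<le> s * norm (R y) * norm y" by (rule mult_right_mono[OF bound]) simp
  finally show ?thesis using False by (simp add: power2_eq_square mult_ac)
qed


lemma bounded_linear_cadjoint:
  fixes T :: "'a::complex_hilbert_space \<Rightarrow> 'b::complex_inner"
  assumes "bounded_clinear T"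
  shows "bounded_linear (cadjoint T)"
proof -
  note adj = cinner_cadjoint[OF assms]
  have T: "bounded_linear T" using assms by (simp add: bounded_clinear_def)
  show ?thesis
  proof (rule bounded_linear_intro)
    show "cadjoint T (x + y) = cadjoint T x + cadjoint T y" for x y
      by (rule cinner_ext) (simp add: adj[symmetric] cinner_add_right)
    show "cadjoint T (r *\<^sub>R x) = r *\<^sub>R cadjoint T x" for r x
      by (rule cinner_ext) (simp add: adj[symmetric] cinner_scaleC_right scaleR_scaleC)
    show "norm (cadjoint T x) \<le> norm x * onorm T" for x
      using norm_adjoint_le[OF adj onorm_pos_le[OF T] onorm[OF T]] by (simp add: mult.commute)
  qed
qed

section \<open>The numerical radius of an off-diagonal operator matrix\<close>

lemma cmod_cinner_offdiag_le:
  assumes A: "bounded_linear A" and B: "bounded_linear B"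
  shows "cmod (cinner (offdiag A B p) p) \<le> (onorm A + onorm B) * (norm p)\<^sup>2"
proof -
  obtain x y where p: "p = (x, y)" by (cases p)
  have "cmod (cinner (A y) x) \<le> onorm A * (norm y * norm x)"
    using cmod_cinner_le[of "A y" x] mult_right_mono[OF onorm[OF A, of y], of "norm x"]
    by (simp add: mult.assoc)
  also have "\<dots> \<le> onorm A * (norm p)\<^sup>2"
    unfolding power2_eq_square p
    by (intro mult_left_mono mult_mono norm_fst_le norm_snd_le onorm_pos_le A) auto
  finally have a: "cmod (cinner (A y) x) \<le> onorm A * (norm p)\<^sup>2" .
  have "cmod (cinner (B x) y) \<le> onorm B * (norm x * norm y)"
    using cmod_cinner_le[of "B x" y] mult_right_mono[OF onorm[OF B, of x], of "norm y"]
    by (simp add: mult.assoc)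
  also have "\<dots> \<le> onorm B * (norm p)\<^sup>2"
    unfolding power2_eq_square p
    by (intro mult_left_mono mult_mono norm_fst_le norm_snd_le onorm_pos_le B) auto
  finally have b: "cmod (cinner (B x) y) \<le> onorm B * (norm p)\<^sup>2" .
  have "cmod (cinner (offdiag A B p) p) \<le> cmod (cinner (A y) x) + cmod (cinner (B x) y)"
    by (simp add: p offdiag_def cinner_prod_def norm_triangle_ineq)
  with a b show ?thesis by (simp add: distrib_right)
qed

lemma offdiag_scaleC:
  assumes "bounded_clinear A" and "bounded_clinear B"
  shows "offdiag A B (c *\<^sub>C p) = c *\<^sub>C offdiag A B p"
  using assms by (auto simp: offdiag_def scaleC_prod_def bounded_clinear_def split: prod.split)

lemma bdd_above_numerical_range:
  assumes "\<And>p. cmod (cinner (T p) p) \<le> M * (norm p)\<^sup>2"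
  shows "bdd_above (insert 0 {cmod (cinner (T x) x) |x. norm x = 1})"
  proof (rule bdd_aboveI[where M = "max 0 M"])
  fix r assume "r \<in> insert 0 {cmod (cinner (T x) x) |x. norm x = 1}"
  then show "r \<le> max 0 M"
    using assms by (auto simp: le_max_iff_disj) (metis mult.right_neutral power_one)
qed

lemma cmod_cinner_le_numerical_radius:
  assumes scale: "\<And>c p. T (c *\<^sub>C p) = c *\<^sub>C T p"
    and bound: "\<And>p. cmod (cinner (T p) p) \<le> M * (norm p)\<^sup>2"
  shows "cmod (cinner (T p) p) \<le> numerical_radius T * (norm p)\<^sup>2"
proof (cases "p = 0")
  case True
  then show ?thesis using bound[of p] by simp
next
  case False
  define c where "c = complex_of_real (1 / norm p)"
  have "norm (c *\<^sub>C p) = 1" using False by (simp add: norm_scaleC c_def norm_divide)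
  then have "cmod (cinner (T (c *\<^sub>C p)) (c *\<^sub>C p)) \<le> numerical_radius T"
    unfolding numerical_radius_def
    by (intro cSup_upper bdd_above_numerical_range[OF bound]) auto
  then have "cmod (cinner (T p) p) / (norm p)\<^sup>2 \<le> numerical_radius T"
    by (simp add: scale cinner_scaleC_left cinner_scaleC_right norm_mult c_def norm_divide
        power2_eq_square)
  then show ?thesis using False by (simp add: divide_le_eq)
qed

text \<open>The hypothesis is applied to the pair \<open>\<parallel>y\<parallel> S y\<close>, \<open>\<parallel>S y\<parallel> y\<close>. These two vectors have equal
  norms, so the sum of squares is twice the product of the norms and nothing is lost.\<close>

lemma onorm_le_of_inner_bound:
  fixes S :: "'a::real_inner \<Rightarrow> 'b::real_inner"
  assumes S: "linear S" and "0 \<le> w"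
    and bound: "\<And>x y. S y \<bullet> x \<le> w * ((norm x)\<^sup>2 + (norm y)\<^sup>2)"
  shows "onorm S \<le> 2 * w"
proof (rule onorm_bound)
  show "0 \<le> 2 * w" using \<open>0 \<le> w\<close> by simp
next
  fix y
  show "norm (S y) \<le> 2 * w * norm y"
  proof (cases "S y = 0 \<or> y = 0")
    case True
    then show ?thesis using \<open>0 \<le> w\<close> by (auto simp: linear_0[OF S])
  next
    case False
    define a b where "a = norm (S y)" and "b = norm y"
    have pos: "a > 0" "b > 0" using False by (auto simp: a_def b_def)
    have "S (a *\<^sub>R y) \<bullet> (b *\<^sub>R S y) = a * b * a\<^sup>2"
      by (simp add: linear_scale[OF S] a_def power2_norm_eq_inner)
    moreover have "(norm (b *\<^sub>R S y))\<^sup>2 + (norm (a *\<^sub>R y))\<^sup>2 = 2 * (a * b)\<^sup>2"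
      by (simp add: a_def b_def power_mult_distrib)
    ultimately have "a * b * a\<^sup>2 \<le> w * (2 * (a * b)\<^sup>2)"
      using bound[of "a *\<^sub>R y" "b *\<^sub>R S y"] by metis
    then have "(a\<^sup>2 * b) * a \<le> (a\<^sup>2 * b) * (2 * w * b)"
      by (simp add: power2_eq_square mult_ac)
    then have "a \<le> 2 * w * b" using pos by simp
    then show ?thesis by (simp add: a_def b_def)
  qed
qed

lemma half_onorm_le_numerical_radius_offdiag:
  fixes A B :: "'a::complex_hilbert_space \<Rightarrow> 'a"
  assumes A: "bounded_clinear A" and B: "bounded_clinear B"
  shows "onorm (\<lambda>x. A x + cadjoint B x) \<le> 2 * numerical_radius (offdiag A B)"
    and "onorm (\<lambda>x. A x - cadjoint B x) \<le> 2 * numerical_radius (offdiag A B)"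
proof -
  let ?w = "numerical_radius (offdiag A B)"
  have blA: "bounded_linear A" and blB: "bounded_linear B"
    using A B by (auto simp: bounded_clinear_def)
  have w_nonneg: "0 \<le> ?w"
    unfolding numerical_radius_def
    by (intro cSup_upper bdd_above_numerical_range[OF cmod_cinner_offdiag_le[OF blA blB]]) simp
  have lin: "linear A" "linear (cadjoint B)"
    using blA bounded_linear_cadjoint[OF B] by (auto intro: bounded_linear.linear)
  have quad: "cmod (cinner (A y) x + cnj (cinner (cadjoint B y) x))
      \<le> ?w * ((norm x)\<^sup>2 + (norm y)\<^sup>2)" for x y
  proof -
    have "cinner (offdiag A B (x, y)) (x, y) = cinner (A y) x + cnj (cinner (cadjoint B y) x)"
      using cinner_cadjoint[OF B, of x y] cinner_commute[of x "cadjoint B y"]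
      by (simp add: offdiag_def cinner_prod_def)
    then show ?thesis
      using cmod_cinner_le_numerical_radius[OF offdiag_scaleC[OF A B]
          cmod_cinner_offdiag_le[OF blA blB], of "(x, y)"]
      by (simp add: norm_prod_def)
  qed
  show "onorm (\<lambda>x. A x + cadjoint B x) \<le> 2 * ?w"
  proof (rule onorm_le_of_inner_bound[OF _ w_nonneg])
    show "linear (\<lambda>x. A x + cadjoint B x)" using lin by (rule linear_compose_add)
    show "(A y + cadjoint B y) \<bullet> x \<le> ?w * ((norm x)\<^sup>2 + (norm y)\<^sup>2)" for x y
      using quad[of y x] complex_Re_le_cmod[of "cinner (A y) x + cnj (cinner (cadjoint B y) x)"]
      by (simp add: inner_eq_Re_cinner cinner_add_left)
  qed
  show "onorm (\<lambda>x. A x - cadjoint B x) \<le> 2 * ?w"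
  proof (rule onorm_le_of_inner_bound[OF _ w_nonneg])
    show "linear (\<lambda>x. A x - cadjoint B x)" using lin by (rule linear_compose_sub)
    \<comment> \<open>the imaginary part of \<open>\<langle>Dy, - \<i> x\<rangle>\<close> is the real part of \<open>\<langle>Dy, x\<rangle>\<close>, for \<open>D = A - B*\<close>\<close>
    show "(A y - cadjoint B y) \<bullet> x \<le> ?w * ((norm x)\<^sup>2 + (norm y)\<^sup>2)" for x y
      using quad[of y "(- \<i>) *\<^sub>C x"]
        abs_Im_le_cmod[of "cinner (A y) ((- \<i>) *\<^sub>C x) + cnj (cinner (cadjoint B y) ((- \<i>) *\<^sub>C x))"]
      by (simp add: inner_eq_Re_cinner cinner_diff_left cinner_scaleC_right norm_scaleC)
  qed
qed

section \<open>Cartesian parts\<close>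

lemma scaleC_diff_right: "c *\<^sub>C (x - y) = c *\<^sub>C x - c *\<^sub>C (y :: 'a::complex_inner)"
  by (metis add_diff_cancel_right' diff_add_cancel scaleC_add_right)

lemma Re_op_plus_i_Im_op:
  "Re_op S x + \<i> *\<^sub>C Im_op T x = (1 / 2) *\<^sub>R ((S x - cadjoint T x) + (cadjoint S x + T x))"
  by (simp add: Re_op_def Im_op_def scaleC_scaleC scaleR_scaleC scaleC_add_right
      scaleC_diff_right)

text \<open>The two groups in the Cartesian formula are \<open>A - B*\<close> and \<open>(A + B*)*\<close> for the first
  combination, and \<open>- (A - B*)*\<close> and \<open>A + B*\<close> for the second; passing to the adjoint preserves
  their norm bounds.\<close>

lemma onorm_Re_op_plus_i_Im_op_le:
  fixes A B :: "'a::complex_hilbert_space \<Rightarrow> 'a"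
  assumes A: "bounded_clinear A" and B: "bounded_clinear B"
  defines "s \<equiv> onorm (\<lambda>x. A x + cadjoint B x)" and "d \<equiv> onorm (\<lambda>x. A x - cadjoint B x)"
  shows "onorm (\<lambda>x. Re_op A x + \<i> *\<^sub>C Im_op B x) \<le> (s + d) / 2"
    and "onorm (\<lambda>x. Re_op B x + \<i> *\<^sub>C Im_op A x) \<le> (s + d) / 2"
proof -
  note adjA = cinner_cadjoint[OF A] and adjB = cinner_cadjoint[OF B]
  have bl: "bounded_linear A" "bounded_linear (cadjoint B)"
    using A bounded_linear_cadjoint[OF B] by (auto simp: bounded_clinear_def)
  have blS: "bounded_linear (\<lambda>x. A x + cadjoint B x)" using bl by (rule bounded_linear_add)
  have blD: "bounded_linear (\<lambda>x. A x - cadjoint B x)" using bl by (rule bounded_linear_sub)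
  have nonneg: "0 \<le> (s + d) / 2"
    using onorm_pos_le[OF blS] onorm_pos_le[OF blD] by (simp add: s_def d_def)
  have S: "norm (A x + cadjoint B x) \<le> s * norm x" for x
    unfolding s_def using onorm[OF blS] .
  have D: "norm (A x - cadjoint B x) \<le> d * norm x" for x
    unfolding d_def using onorm[OF blD] .
  have adjB': "cinner (cadjoint B x) y = cinner x (B y)" for x y
    by (metis adjB cinner_commute)
  have S': "norm (cadjoint A x + B x) \<le> s * norm x" for x
    by (rule norm_adjoint_le[of "\<lambda>x. A x + cadjoint B x"])
      (use S onorm_pos_le[OF blS] in \<open>auto simp: s_def cinner_add_left cinner_add_right adjA adjB'\<close>)
  have D': "norm (cadjoint A x - B x) \<le> d * norm x" for x
    by (rule norm_adjoint_le[of "\<lambda>x. A x - cadjoint B x"])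
      (use D onorm_pos_le[OF blD] in \<open>auto simp: d_def cinner_diff_left cinner_diff_right adjA adjB'\<close>)
  show "onorm (\<lambda>x. Re_op A x + \<i> *\<^sub>C Im_op B x) \<le> (s + d) / 2"
  proof (rule onorm_bound[OF nonneg])
    fix x
    show "norm (Re_op A x + \<i> *\<^sub>C Im_op B x) \<le> (s + d) / 2 * norm x"
      unfolding Re_op_plus_i_Im_op
      using norm_triangle_ineq[of "A x - cadjoint B x" "cadjoint A x + B x"] D[of x] S'[of x]
      by (simp add: distrib_right)
  qed
  show "onorm (\<lambda>x. Re_op B x + \<i> *\<^sub>C Im_op A x) \<le> (s + d) / 2"
  proof (rule onorm_bound[OF nonneg])
    fix x
    show "norm (Re_op B x + \<i> *\<^sub>C Im_op A x) \<le> (s + d) / 2 * norm x"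
      unfolding Re_op_plus_i_Im_op
      using norm_triangle_ineq[of "B x - cadjoint A x" "cadjoint B x + A x"] D'[of x] S[of x]
      by (simp add: distrib_right add.commute norm_minus_commute)
  qed
qed

theorem theorem2p13:
  fixes A B :: "'a::complex_hilbert_space \<Rightarrow> 'a"
  assumes "bounded_clinear A" and "bounded_clinear B"
  shows "numerical_radius (offdiag A B) \<ge>
           1 / 2 * onorm (\<lambda>x. Re_op A x + \<i> *\<^sub>C Im_op B x)
           + 1 / 4 * \<bar>onorm (\<lambda>x. A x + cadjoint B x) - onorm (\<lambda>x. A x - cadjoint B x)\<bar>
         \<and> numerical_radius (offdiag A B) \<ge>
           1 / 2 * onorm (\<lambda>x. Re_op B x + \<i> *\<^sub>C Im_op A x)
           + 1 / 4 * \<bar>onorm (\<lambda>x. A x + cadjoint B x) - onorm (\<lambda>x. A x - cadjoint B x)\<bar>"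
proof -
  note w = half_onorm_le_numerical_radius_offdiag[OF assms]
  note cartesian = onorm_Re_op_plus_i_Im_op_le[OF assms]
  have "1 / 2 * p + 1 / 4 * \<bar>s - d\<bar> \<le> r"
    if "s \<le> 2 * r" "d \<le> 2 * r" "p \<le> (s + d) / 2" for p r s d :: real
    using that by (auto simp: abs_if field_simps)
  then show ?thesis using w cartesian by blast
qed

end
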